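(* Let $d\ge 2$, $\mu\in\mathbb{S}^{d-1}$, $\kappa \ge 0$, and set $\alpha=\frac{d-1}{2}+\kappa$, $\beta=\frac{d-1}{2}$. Then $$\int_{\mathbb{S}^{d-1}} (1+\mu^\top x)^\kappa \, d\sigma(x) = 2^{\alpha+\beta}\pi^{\beta}\frac{\Gamma(\alpha)}{\Gamma(\alpha+\beta)},$$ so the normalized density of the Power Spherical distribution is $$p_X(x;\mu,\kappa) = \left\{2^{\alpha+\beta}\pi^{\beta}\frac{\Gamma(\alpha)}{\Gamma(\alpha+\beta)}\right\}^{-1}(1+\mu^\top x)^\kappa, \quad x\in\mathbb{S}^{d-1}.$$
   Context: $\mathbb{S}^{d-1}=\{x\in\mathbb{R}^d:\|x\|_2=1\}$ and $\sigma$ denotes the (unnormalized) surface measure on $\mathbb{S}^{d-1}$, of total mass $2\pi^{d/2}/\Gamma(d/2)$. The Power Spherical distribution with direction $\mu$ and concentration $\kappa$ is the probability distribution on $\mathbb{S}^{d-1}$ with density w.r.t. $\sigma$ proportional to $(1+\mu^\top x)^\kappa$. *)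

theory Defs
  imports "HOL-Analysis.Analysis"
begin

text \<open>Unnormalized surface measure on the unit sphere of a Euclidean space,
  defined as the cone measure: sigma(A) = d * lambda({t x | x in A, 0 < t <= 1}),
  where d = DIM('a). This is the standard surface (Hausdorff) measure on the sphere,
  with total mass d * vol(unit ball) = 2 pi^(d/2) / Gamma(d/2).\<close>
definition sphere_measure :: "'a::euclidean_space measure" where
  "sphere_measure =
     scale_measure (of_nat DIM('a))
       (distr (restrict_space lborel (cball 0 1 - {0}))
              (restrict_space borel (sphere 0 1))
              (\<lambda>x. x /\<^sub>R norm x))"

definition power_spherical_density :: "'a::euclidean_space \<Rightarrow> real \<Rightarrow> 'a \<Rightarrow> real" where
  "power_spherical_density \<mu> \<kappa> x =
     (let \<alpha> = (real DIM('a) - 1) / 2 + \<kappa>; \<beta> = (real DIM('a) - 1) / 2 in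
      (1 + \<mu> \<bullet> x) powr \<kappa> /
        (2 powr (\<alpha> + \<beta>) * pi powr \<beta> * Gamma \<alpha> / Gamma (\<alpha> + \<beta>)))"

end

theory Submission
  imports Defs
begin

text \<open>Write \<open>h\<close> for the degree-0 homogeneous extension of the integrand and evaluate
  \<open>J = \<integral> h(x) |x|^(\<kappa>-1) exp(-|x|) dx\<close> over the whole space in two ways. In polar coordinates
  \<open>J\<close> is the wanted spherical integral times \<open>\<Gamma>(\<alpha>+\<beta>)\<close>. After rotating \<open>\<mu>\<close> onto a basis vector,
  cylindrical coordinates \<open>(s, t) = (\<mu> \<bullet> x, |x|)\<close> turn the integrand into
  \<open>(t+s)^(\<alpha>-1) (t-s)^(\<beta>-1) exp(-t)\<close>, which in the variables \<open>t + s\<close> and \<open>t - s\<close> is a product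
  of two Gamma integrals. Both coordinate changes only need the volume of balls: they push
  a measure forward along the norm, and a measure on the line is determined by its distribution
  function.\<close>

section \<open>Measures on the line and their distribution functions\<close>

text \<open>The closed half-lines form an intersection-stable generator of the Borel sets, so
  agreement on them suffices. \<open>F\<close> is differentiated only to the right of
  \<open>c\<close>, with mere continuity at \<open>c\<close>, because the densities used later may
  blow up there.\<close>

lemma density_eqI_cdf:
  fixes F f :: "real \<Rightarrow> real"
  assumes sets: "sets N = sets borel"
    and f [measurable]: "f \<in> borel_measurable borel" and nonneg: "\<And>t. c < t \<Longrightarrow> 0 \<le> f t"
    and cont: "continuous_on {c..} F" and "F c = 0"
    and deriv: "\<And>t. c < t \<Longrightarrow> (F has_real_derivative f t) (at t)"
    and cdf: "\<And>t. c < t \<Longrightarrow> emeasure N {..t} = ennreal (F t)"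
  shows "N = density lborel (\<lambda>t. ennreal (f t) * indicator {c<..} t)"
proof -
  let ?M = "density lborel (\<lambda>t. ennreal (f t) * indicator {c<..} t)"
  \<comment> \<open>Monotonicity bounds this mass by \<open>F u\<close> for every
    \<open>u > c\<close>; letting \<open>u\<close> decrease to \<open>c\<close> leaves
    \<open>F c = 0\<close>.\<close>
  have N0: "emeasure N {..t} = 0" if "t \<le> c" for t
  proof -
    have "(F \<longlongrightarrow> F c) (at c within {c..})"
      using cont by (auto simp: continuous_on_def)
    then have "((\<lambda>u. ennreal (F u)) \<longlongrightarrow> ennreal (F c)) (at_right c)"
      by (intro tendsto_ennrealI) (auto intro: tendsto_within_subset)
    moreover have "\<forall>\<^sub>F u in at_right c. emeasure N {..t} \<le> ennreal (F u)"
    proof (rule eventually_at_right_less[THEN eventually_mono])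
      fix u assume "c < u"
      then have "emeasure N {..t} \<le> emeasure N {..u}"
        using that by (intro emeasure_mono) (auto simp: sets)
      then show "emeasure N {..t} \<le> ennreal (F u)"
        using cdf[OF \<open>c < u\<close>] by simp
    qed
    ultimately have "emeasure N {..t} \<le> ennreal (F c)"
      by (intro tendsto_lowerbound) auto
    then show ?thesis using \<open>F c = 0\<close> by simp
  qed
  have M: "emeasure ?M {..t} = (\<integral>\<^sup>+ x. ennreal (f x) * indicator {c<..t} x \<partial>lborel)" for t
    by (subst emeasure_density) (auto intro!: nn_integral_cong split: split_indicator)
  have M1: "emeasure ?M {..t} = ennreal (F t)" if "c < t" for t
  proof -
    \<comment> \<open>This form of the fundamental theorem asks for the derivative only in the open
      interval, so \<open>f\<close> may be unbounded near \<open>c\<close>.\<close>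
    have "(f has_integral (F t - F c)) {c..t}"
      using that deriv
      by (intro fundamental_theorem_of_calculus_interior)
         (auto intro!: continuous_on_subset[OF cont] simp: has_real_derivative_iff_has_vector_derivative)
    then have "(f has_integral F t) {c<..t}"
      using \<open>F c = 0\<close> by (subst has_integral_spike_set_eq[of _ "{c..t}"])
        (auto intro: negligible_subset[of "{c}"])
    then have "((\<lambda>x. indicator {c<..t} x * f x) has_integral F t) UNIV"
      by (subst (asm) has_integral_restrict_UNIV[symmetric])
         (auto elim!: has_integral_eq[rotated] simp: indicator_def)
    then have "(\<integral>\<^sup>+ x. ennreal (indicator {c<..t} x * f x) \<partial>lborel) = ennreal (F t)"
      by (intro nn_integral_has_integral_lborel) (auto intro: nonneg simp: indicator_def)
    then show ?thesis
      unfolding M by (simp add: ennreal_mult'' ennreal_indicator mult.commute ennreal_mult')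
  qed
  have M0: "emeasure ?M {..t} = 0" if "t \<le> c" for t
    using that unfolding M by simp
  have sigma: "sets (borel :: real measure) = sigma_sets UNIV (range (\<lambda>a. {..a}))"
    by (subst borel_eq_atMost) (simp add: sets_measure_of)
  show ?thesis
  proof (rule measure_eqI_generator_eq[where \<Omega> = UNIV and E = "range (\<lambda>a::real. {..a})"
        and A = "\<lambda>n. {..real n}"])
    show "Int_stable (range (\<lambda>a::real. {..a}))"
      by (auto simp: Int_stable_def)
    show "emeasure N X = emeasure ?M X" if "X \<in> range (\<lambda>a::real. {..a})" for X
    proof -
      from that obtain a where "X = {..a}" by blast
      then show ?thesis
        using N0[of a] M0[of a] M1[of a] cdf[of a] by (cases "a \<le> c") auto
    qed
    show "emeasure N {..real n} \<noteq> \<infinity>" for n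
      using N0[of "real n"] cdf[of "real n"] by (cases "real n \<le> c") auto
    show "(\<Union>n. {..real n}) = UNIV"
      by (auto simp: real_arch_simple)
  qed (auto simp: sets sigma)
qed

section \<open>Translation and rotation invariance of Lebesgue measure\<close>

lemma nn_integral_lborel_translate:
  fixes f :: "'a::euclidean_space \<Rightarrow> ennreal"
  assumes [measurable]: "f \<in> borel_measurable borel"
  shows "(\<integral>\<^sup>+ x. f (c + x) \<partial>lborel) = (\<integral>\<^sup>+ x. f x \<partial>lborel)"
proof -
  have "(\<integral>\<^sup>+ x. f x \<partial>lborel) = (\<integral>\<^sup>+ x. f x \<partial>distr lborel borel ((+) c))"
    by (simp add: lborel_distr_plus)
  also have "\<dots> = (\<integral>\<^sup>+ x. f (c + x) \<partial>lborel)"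
    by (subst nn_integral_distr) auto
  finally show ?thesis ..
qed

text \<open>This is the uniqueness argument for Haar measure. Tested against the indicator of a
  ball, which the isometry preserves, the proportionality constant is 1.\<close>
lemma nn_integral_orthogonal_transformation:
  fixes f :: "'a::euclidean_space \<Rightarrow> ennreal" and T :: "'a \<Rightarrow> 'a"
  assumes T: "orthogonal_transformation T" and f [measurable]: "f \<in> borel_measurable borel"
  shows "(\<integral>\<^sup>+ x. f (T x) \<partial>lborel) = (\<integral>\<^sup>+ x. f x \<partial>lborel)"
proof -
  have lin: "linear T" and nrm: "\<And>x. norm (T x) = norm x"
    using T by (auto simp: orthogonal_transformation)
  have [measurable]: "T \<in> borel_measurable borel"
    using lin by (intro borel_measurable_continuous_onI linear_continuous_on) (simp add: linear_conv_bounded_linear)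
  \<comment> \<open>A norm-preserving linear map is injective, hence surjective in finite
    dimension.\<close>
  have TS: "T (inv T y) = y" for y
  proof -
    have "inj T"
      unfolding linear_injective_0[OF lin]
    proof (intro allI impI)
      fix a assume "T a = 0"
      with nrm[of a] show "a = 0" by simp
    qed
    then have "surj T"
      using linear_injective_imp_surjective[OF lin] by simp
    then show ?thesis by (simp add: surj_f_inv_f)
  qed
  define g :: "'a \<Rightarrow> ennreal" where "g = indicator (cball 0 1)"
  have [measurable]: "g \<in> borel_measurable borel"
    unfolding g_def by (intro borel_measurable_indicator) auto
  have gn: "g x = g y" if "norm x = norm y" for x y
    using that by (simp add: g_def indicator_def)
  define G where "G = (\<integral>\<^sup>+ x. g x \<partial>lborel)"
  have Gval: "G = ennreal (unit_ball_vol (DIM('a)))"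
    unfolding G_def g_def using emeasure_cball[of 1 "0::'a"] by simp
  \<comment> \<open>The factor \<open>G\<close> supplies a second variable \<open>y\<close>.
    Shifting \<open>x\<close> by \<open>inv T y\<close>, exchanging the integrals and then shifting
    \<open>y\<close> by \<open>T x\<close> moves \<open>T\<close> from \<open>f\<close> into
    \<open>g\<close>, which sees only norms.\<close>
  have "(\<integral>\<^sup>+ x. f (T x) \<partial>lborel) * G = (\<integral>\<^sup>+ y. (\<integral>\<^sup>+ x. f (T x) \<partial>lborel) * g y \<partial>lborel)"
    unfolding G_def by (subst nn_integral_cmult) auto
  also have "\<dots> = (\<integral>\<^sup>+ y. (\<integral>\<^sup>+ x. f (T x + y) * g y \<partial>lborel) \<partial>lborel)"
  proof (rule nn_integral_cong)
    fix y :: 'a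
    have "(\<integral>\<^sup>+ x. f (T x) \<partial>lborel) = (\<integral>\<^sup>+ x. f (T (inv T y + x)) \<partial>lborel)"
      by (subst nn_integral_lborel_translate[where f = "\<lambda>x. f (T x)"]) auto
    also have "\<dots> = (\<integral>\<^sup>+ x. f (T x + y) \<partial>lborel)"
      by (simp add: linear_add[OF lin] TS add.commute)
    finally show "(\<integral>\<^sup>+ x. f (T x) \<partial>lborel) * g y = (\<integral>\<^sup>+ x. f (T x + y) * g y \<partial>lborel)"
      by (simp add: nn_integral_multc)
  qed
  also have "\<dots> = (\<integral>\<^sup>+ x. (\<integral>\<^sup>+ y. f (T x + y) * g y \<partial>lborel) \<partial>lborel)"
    by (subst lborel_pair.Fubini') auto
  also have "\<dots> = (\<integral>\<^sup>+ x. (\<integral>\<^sup>+ y. f y * g (y - T x) \<partial>lborel) \<partial>lborel)"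
  proof (rule nn_integral_cong)
    fix x :: 'a
    show "(\<integral>\<^sup>+ y. f (T x + y) * g y \<partial>lborel) = (\<integral>\<^sup>+ y. f y * g (y - T x) \<partial>lborel)"
      by (subst nn_integral_lborel_translate[where c = "T x" and f = "\<lambda>y. f y * g (y - T x)", symmetric]) auto
  qed
  also have "\<dots> = (\<integral>\<^sup>+ y. (\<integral>\<^sup>+ x. f y * g (y - T x) \<partial>lborel) \<partial>lborel)"
    by (subst lborel_pair.Fubini') auto
  also have "\<dots> = (\<integral>\<^sup>+ y. f y * G \<partial>lborel)"
  proof (rule nn_integral_cong)
    fix y :: 'a
    have "g (y - T x) = g (x - inv T y)" for x
    proof (rule gn)
      have "norm (y - T x) = norm (T (inv T y - x))"
        by (simp add: linear_diff[OF lin] TS)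
      then show "norm (y - T x) = norm (x - inv T y)"
        by (simp add: nrm norm_minus_commute)
    qed
    then have "(\<integral>\<^sup>+ x. g (y - T x) \<partial>lborel) = (\<integral>\<^sup>+ x. g (- inv T y + x) \<partial>lborel)"
      by (simp add: add.commute)
    also have "\<dots> = G"
      unfolding G_def by (rule nn_integral_lborel_translate) simp
    finally show "(\<integral>\<^sup>+ x. f y * g (y - T x) \<partial>lborel) = f y * G"
      by (simp add: nn_integral_cmult)
  qed
  also have "\<dots> = (\<integral>\<^sup>+ y. f y \<partial>lborel) * G"
    by (simp add: nn_integral_multc)
  finally have *: "(\<integral>\<^sup>+ x. f (T x) \<partial>lborel) * G = (\<integral>\<^sup>+ y. f y \<partial>lborel) * G" .
  moreover have "G \<noteq> 0" "G \<noteq> top"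
    using unit_ball_vol_pos[of "DIM('a)"] by (auto simp: Gval simp del: unit_ball_vol_pos)
  ultimately show ?thesis
    by (metis ennreal_mult_cancel_left mult.commute)
qed

text \<open>Householder reflection in the bisecting hyperplane; for equal vectors the division by zero
  makes it the identity.\<close>
lemma orthogonal_transformation_exists_euclidean:
  fixes a b :: "'a::euclidean_space"
  assumes "norm a = norm b"
  obtains T where "orthogonal_transformation T" "T a = b"
proof -
  define v where "v = a - b"
  define T where "T x = x - (2 * (v \<bullet> x) / (v \<bullet> v)) *\<^sub>R v" for x
  have ab: "a \<bullet> a = b \<bullet> b" using assms by (simp add: norm_eq)
  have "linear T"
    by (rule linearI) (auto simp: T_def algebra_simps inner_add_right add_divide_distrib)
  moreover have "T x \<bullet> T y = x \<bullet> y" for x y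
    by (cases "v = 0") (auto simp: T_def inner_diff_left inner_diff_right inner_commute field_simps)
  ultimately have "orthogonal_transformation T"
    by (auto simp: orthogonal_transformation_def)
  moreover have "T a = b"
  proof (cases "v = 0")
    case False
    have "v \<bullet> v = 2 * (v \<bullet> a)"
      using ab by (simp add: v_def inner_diff_left inner_diff_right inner_commute)
    with False have "2 * (v \<bullet> a) / (v \<bullet> v) = 1" by (metis divide_self inner_eq_zero_iff)
    then show ?thesis by (simp only: T_def) (simp add: v_def)
  qed (simp add: T_def v_def)
  ultimately show ?thesis by (rule that)
qed

section \<open>Gamma integrals\<close>

text \<open>Rescaling by 2 reduces this to Euler's integral. The rate 1/2 arises from splitting
  \<open>exp (- t)\<close> evenly between the variables \<open>t + s\<close> and
  \<open>t - s\<close>.\<close>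

lemma nn_integral_gamma_half:
  fixes a :: real
  assumes "a > 0"
  shows "(\<integral>\<^sup>+ x. ennreal (indicator {0<..} x * (x powr (a - 1) * exp (- x / 2))) \<partial>lborel)
    = ennreal (2 powr a * Gamma a)"
proof -
  have "(\<integral>\<^sup>+ x. ennreal (indicator {0<..} x * (x powr (a - 1) * exp (- x / 2))) \<partial>lborel)
    = ennreal 2 * (\<integral>\<^sup>+ x. ennreal (indicator {0<..} (0 + 2 * x) * ((0 + 2 * x) powr (a - 1) * exp (- (0 + 2 * x) / 2))) \<partial>lborel)"
    by (subst nn_integral_real_affine[where c = 2 and t = 0]) auto
  also have "\<dots> = ennreal 2 * (\<integral>\<^sup>+ x. ennreal (2 powr (a - 1)) * ennreal (indicator {0..} x * x powr (a - 1) / exp x) \<partial>lborel)"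
    by (intro arg_cong[where f = "\<lambda>x. ennreal 2 * x"] nn_integral_cong_AE AE_I[of _ _ "{0}"])
       (auto simp: indicator_def powr_mult exp_minus field_simps ennreal_mult[symmetric])
  also have "\<dots> = ennreal 2 * (ennreal (2 powr (a - 1)) * Gamma a)"
    using Gamma_conv_nn_integral_real[OF assms] by (subst nn_integral_cmult) auto
  also have "\<dots> = ennreal (2 powr a * Gamma a)"
    using assms by (simp add: ennreal_mult[symmetric] powr_diff Gamma_real_nonneg del: ennreal_numeral)
  finally show ?thesis .
qed

text \<open>In the variables \<open>p = t + s\<close> and \<open>q = t - s\<close> the integrand
  separates; the Jacobian 1/2 accounts for the \<open>- 1\<close> in the exponent of 2.\<close>

lemma nn_integral_gamma_product:
  fixes a b :: real
  assumes "a > 0" "b > 0"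
  shows "(\<integral>\<^sup>+ s. \<integral>\<^sup>+ t. ennreal (indicator {\<bar>s\<bar><..} t *
      ((t + s) powr (a - 1) * (t - s) powr (b - 1) * exp (- t))) \<partial>lborel \<partial>lborel)
    = ennreal (2 powr (a + b - 1) * Gamma a * Gamma b)"
proof -
  define \<phi> :: "real \<Rightarrow> real \<Rightarrow> ennreal" where
    "\<phi> = (\<lambda>a x. ennreal (indicator {0<..} x * (x powr (a - 1) * exp (- x / 2))))"
  have [measurable]: "\<phi> c \<in> borel_measurable borel" for c
    by (simp add: \<phi>_def)
  \<comment> \<open>The condition \<open>\<bar>s\<bar> < t\<close> says exactly that
    \<open>t + s\<close> and \<open>t - s\<close> are both positive, so it splits into the two
    indicators inside \<open>\<phi>\<close>.\<close>
  have "ennreal (indicator {\<bar>s\<bar><..} t * ((t + s) powr (a - 1) * (t - s) powr (b - 1) * exp (- t)))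
      = \<phi> a (t + s) * \<phi> b (t - s)" for s t
    by (auto simp: \<phi>_def indicator_def ennreal_mult[symmetric] mult_exp_exp field_simps)
  then have "(\<integral>\<^sup>+ s. \<integral>\<^sup>+ t. ennreal (indicator {\<bar>s\<bar><..} t *
      ((t + s) powr (a - 1) * (t - s) powr (b - 1) * exp (- t))) \<partial>lborel \<partial>lborel)
    = (\<integral>\<^sup>+ s. \<integral>\<^sup>+ t. \<phi> a (t + s) * \<phi> b (t - s) \<partial>lborel \<partial>lborel)"
    by simp
  \<comment> \<open>The change of variables is made one variable at a time: \<open>t = s + q\<close>
    for fixed \<open>s\<close>, then, after Fubini, \<open>p = 2 * s + q\<close> for fixed
    \<open>q\<close>.\<close>
  also have "\<dots> = (\<integral>\<^sup>+ s. \<integral>\<^sup>+ q. \<phi> a (2 * s + q) * \<phi> b q \<partial>lborel \<partial>lborel)"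
  proof (rule nn_integral_cong)
    fix s :: real
    show "(\<integral>\<^sup>+ t. \<phi> a (t + s) * \<phi> b (t - s) \<partial>lborel) = (\<integral>\<^sup>+ q. \<phi> a (2 * s + q) * \<phi> b q \<partial>lborel)"
      by (subst nn_integral_real_affine[where c = 1 and t = s]) (auto simp: algebra_simps)
  qed
  also have "\<dots> = (\<integral>\<^sup>+ q. \<integral>\<^sup>+ s. \<phi> a (2 * s + q) * \<phi> b q \<partial>lborel \<partial>lborel)"
    by (subst lborel_pair.Fubini') auto
  also have "\<dots> = (\<integral>\<^sup>+ q. ennreal (1/2) * ennreal (2 powr a * Gamma a) * \<phi> b q \<partial>lborel)"
  proof (rule nn_integral_cong)
    fix q :: real
    have "ennreal (2 powr a * Gamma a) = (\<integral>\<^sup>+ p. \<phi> a p \<partial>lborel)"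
      unfolding \<phi>_def by (rule nn_integral_gamma_half[OF assms(1), symmetric])
    also have "\<dots> = ennreal 2 * (\<integral>\<^sup>+ s. \<phi> a (2 * s + q) \<partial>lborel)"
      by (subst nn_integral_real_affine[where c = 2 and t = q]) (auto simp: add.commute)
    finally have "ennreal (1/2) * ennreal (2 powr a * Gamma a)
        = ennreal (1/2) * ennreal 2 * (\<integral>\<^sup>+ s. \<phi> a (2 * s + q) \<partial>lborel)" by (simp add: mult.assoc)
    also have "ennreal (1/2) * ennreal 2 = 1"
      by (subst ennreal_mult[symmetric]) auto
    finally show "(\<integral>\<^sup>+ s. \<phi> a (2 * s + q) * \<phi> b q \<partial>lborel)
        = ennreal (1/2) * ennreal (2 powr a * Gamma a) * \<phi> b q"
      by (simp add: nn_integral_multc)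
  qed
  also have "\<dots> = ennreal (1/2) * ennreal (2 powr a * Gamma a) * ennreal (2 powr b * Gamma b)"
    using nn_integral_gamma_half[OF assms(2)] by (subst nn_integral_cmult) (auto simp: \<phi>_def)
  also have "\<dots> = ennreal (2 powr (a + b - 1) * Gamma a * Gamma b)"
    using assms by (subst ennreal_mult[symmetric], auto simp: Gamma_real_nonneg)+
      (simp add: powr_add powr_diff mult_ac)
  finally show ?thesis .
qed

section \<open>Cylindrical and polar coordinates\<close>

text \<open>For fixed \<open>s\<close>, the points with radius at most \<open>t\<close> form a ball
  of radius \<open>sqrt (t^2 - s^2)\<close> in \<open>card A\<close> dimensions, and the density is
  the \<open>t\<close>-derivative of its volume. Nonemptiness of \<open>A\<close> keeps the exponent
  \<open>n / 2\<close> of that volume positive, as continuity at \<open>\<bar>s\<bar>\<close>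
  requires.\<close>

lemma nn_integral_PiM_radial:
  fixes g :: "real \<Rightarrow> ennreal" and s :: real and A :: "'i set"
  assumes "finite A" "A \<noteq> {}" and [measurable]: "g \<in> borel_measurable borel"
  shows "(\<integral>\<^sup>+ y. g (sqrt (s\<^sup>2 + (\<Sum>i\<in>A. (y i)\<^sup>2))) \<partial>Pi\<^sub>M A (\<lambda>_. lborel))
    = (\<integral>\<^sup>+ t. ennreal (real (card A) * unit_ball_vol (card A) * t * (t\<^sup>2 - s\<^sup>2) powr (card A / 2 - 1))
          * indicator {\<bar>s\<bar><..} t * g t \<partial>lborel)"
proof -
  define n where "n = card A"
  have n: "n > 0" using assms by (auto simp: n_def card_gt_0_iff)
  let ?P = "Pi\<^sub>M A (\<lambda>_. lborel :: real measure)"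
  let ?r = "\<lambda>y :: 'i \<Rightarrow> real. sqrt (s\<^sup>2 + (\<Sum>i\<in>A. (y i)\<^sup>2))"
  let ?f = "\<lambda>t. real n * unit_ball_vol n * t * (t\<^sup>2 - s\<^sup>2) powr (n / 2 - 1)"
  have [measurable]: "?r \<in> borel_measurable ?P" by measurable
  have sq: "s\<^sup>2 < t\<^sup>2" if "\<bar>s\<bar> < t" for t
    using that power_strict_mono[of "\<bar>s\<bar>" t 2] by simp
  have "distr ?P borel ?r = density lborel (\<lambda>t. ennreal (?f t) * indicator {\<bar>s\<bar><..} t)"
  proof (rule density_eqI_cdf[where F = "\<lambda>t. unit_ball_vol n * (t\<^sup>2 - s\<^sup>2) powr (n / 2)"])
    show "continuous_on {\<bar>s\<bar>..} (\<lambda>t. unit_ball_vol n * (t\<^sup>2 - s\<^sup>2) powr (n / 2))"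
      using n by (intro continuous_intros continuous_on_powr') (auto simp: abs_le_square_iff[symmetric])
  next
    fix t assume t: "\<bar>s\<bar> < t"
    show "((\<lambda>t. unit_ball_vol n * (t\<^sup>2 - s\<^sup>2) powr (n / 2)) has_real_derivative ?f t) (at t)"
      using sq[OF t] by (auto intro!: derivative_eq_intros)
    show "0 \<le> ?f t" using t by simp
    let ?u = "sqrt (t\<^sup>2 - s\<^sup>2)"
    have u: "?u > 0" using sq[OF t] by simp
    have "emeasure (distr ?P borel ?r) {..t} = emeasure ?P ({y. sqrt (\<Sum>i\<in>A. (y i)\<^sup>2) \<le> ?u} \<inter> space ?P)"
    proof (subst emeasure_distr)
      have "?r y \<le> t \<longleftrightarrow> sqrt (\<Sum>i\<in>A. (y i)\<^sup>2) \<le> ?u" for y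
        using t by (subst real_sqrt_le_iff') (auto simp: sum_nonneg)
      then show "emeasure ?P (?r -` {..t} \<inter> space ?P) = emeasure ?P ({y. sqrt (\<Sum>i\<in>A. (y i)\<^sup>2) \<le> ?u} \<inter> space ?P)"
        by (intro arg_cong[where f = "emeasure ?P"]) auto
    qed auto
    also have "\<dots> = ennreal (unit_ball_vol n * ?u ^ n)"
      unfolding n_def by (rule emeasure_cball_aux[OF assms(1) u])
    also have "?u ^ n = (t\<^sup>2 - s\<^sup>2) powr (n / 2)"
      using sq[OF t] u by (simp add: powr_realpow[symmetric] powr_half_sqrt[symmetric] powr_powr)
    finally show "emeasure (distr ?P borel ?r) {..t} = ennreal (unit_ball_vol n * (t\<^sup>2 - s\<^sup>2) powr (n / 2))" .
  qed (use n in auto)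
  then have "(\<integral>\<^sup>+ t. g t \<partial>distr ?P borel ?r) = (\<integral>\<^sup>+ t. g t \<partial>density lborel (\<lambda>t. ennreal (?f t) * indicator {\<bar>s\<bar><..} t))"
    by simp
  then show ?thesis
    unfolding n_def by (subst (asm) nn_integral_distr) (auto simp: nn_integral_density)
qed

text \<open>Fubini splits off the coordinate along \<open>b\<close>. The remaining coordinates, at
  least one by the dimension bound, enter only through the norm, so the radial formula applies to
  them.\<close>

lemma nn_integral_cylindrical:
  fixes b :: "'a::euclidean_space" and G :: "real \<Rightarrow> real \<Rightarrow> ennreal"
  assumes "DIM('a) \<ge> 2" "b \<in> Basis"
    and [measurable]: "case_prod G \<in> borel_measurable (borel \<Otimes>\<^sub>M borel)"
  defines "n \<equiv> DIM('a) - 1"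
  shows "(\<integral>\<^sup>+ x. G (b \<bullet> x) (norm x) \<partial>lborel)
    = (\<integral>\<^sup>+ s. \<integral>\<^sup>+ t. ennreal (real n * unit_ball_vol n * t * (t\<^sup>2 - s\<^sup>2) powr (n / 2 - 1))
          * indicator {\<bar>s\<bar><..} t * G s t \<partial>lborel \<partial>lborel)"
proof -
  interpret product_sigma_finite "\<lambda>_. lborel :: real measure" by standard
  define A where "A = Basis - {b}"
  have A: "finite A" "b \<notin> A" "insert b A = Basis" "card A = n"
    using assms(2) by (auto simp: A_def n_def card_Diff_singleton)
  have "A \<noteq> {}" using A assms(1) by (auto simp: n_def)
  let ?V = "\<lambda>f. \<Sum>i\<in>Basis. f i *\<^sub>R i :: 'a"
  have V: "b \<bullet> ?V f = f b" "norm (?V f) = sqrt ((f b)\<^sup>2 + (\<Sum>i\<in>A. (f i)\<^sup>2))" for f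
  proof -
    show "b \<bullet> ?V f = f b"
      using assms(2) by (subst inner_commute) (simp add: inner_sum_left_Basis)
    have "norm (?V f) = sqrt (\<Sum>i\<in>Basis. (f i)\<^sup>2)"
      using norm_eq_sqrt_inner[of "?V f"] euclidean_inner[of "?V f" "?V f"]
      by (simp add: power2_eq_square)
    also have "(\<Sum>i\<in>Basis. (f i)\<^sup>2) = (f b)\<^sup>2 + (\<Sum>i\<in>A. (f i)\<^sup>2)"
      using A(1,2) by (simp flip: A(3))
    finally show "norm (?V f) = sqrt ((f b)\<^sup>2 + (\<Sum>i\<in>A. (f i)\<^sup>2))" .
  qed
  have [measurable]: "(\<lambda>f. G (f b) (sqrt ((f b)\<^sup>2 + (\<Sum>i\<in>A. (f i)\<^sup>2)))) \<in> borel_measurable (Pi\<^sub>M (insert b A) (\<lambda>_. lborel))"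
    by measurable
  have "(\<integral>\<^sup>+ x. G (b \<bullet> x) (norm x) \<partial>lborel) = (\<integral>\<^sup>+ f. G (b \<bullet> ?V f) (norm (?V f)) \<partial>Pi\<^sub>M Basis (\<lambda>_. lborel))"
    by (subst lborel_eq) (subst nn_integral_distr, auto)
  also have "\<dots> = (\<integral>\<^sup>+ f. G (f b) (sqrt ((f b)\<^sup>2 + (\<Sum>i\<in>A. (f i)\<^sup>2))) \<partial>Pi\<^sub>M (insert b A) (\<lambda>_. lborel))"
    by (simp only: V A(3))
  also have "\<dots> = (\<integral>\<^sup>+ s. \<integral>\<^sup>+ y. G s (sqrt (s\<^sup>2 + (\<Sum>i\<in>A. (y i)\<^sup>2))) \<partial>Pi\<^sub>M A (\<lambda>_. lborel) \<partial>lborel)"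
  \<comment> \<open>Since \<open>b\<close> lies outside \<open>A\<close>, resetting the coordinate
    \<open>b\<close> leaves the sum over \<open>A\<close> unchanged.\<close>
  proof (subst product_nn_integral_insert_rev[OF A(1,2)], measurable)
    have "(\<Sum>i\<in>A. ((y(b := s)) i)\<^sup>2) = (\<Sum>i\<in>A. (y i)\<^sup>2)" for y :: "'a \<Rightarrow> real" and s
      using A(2) by (intro sum.cong) auto
    then show "(\<integral>\<^sup>+ s. \<integral>\<^sup>+ y. G ((y(b := s)) b) (sqrt (((y(b := s)) b)\<^sup>2 + (\<Sum>i\<in>A. ((y(b := s)) i)\<^sup>2))) \<partial>Pi\<^sub>M A (\<lambda>_. lborel) \<partial>lborel)
      = (\<integral>\<^sup>+ s. \<integral>\<^sup>+ y. G s (sqrt (s\<^sup>2 + (\<Sum>i\<in>A. (y i)\<^sup>2))) \<partial>Pi\<^sub>M A (\<lambda>_. lborel) \<partial>lborel)"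
      by simp
  qed
  also have "\<dots> = (\<integral>\<^sup>+ s. \<integral>\<^sup>+ t. ennreal (real n * unit_ball_vol n * t * (t\<^sup>2 - s\<^sup>2) powr (n / 2 - 1))
          * indicator {\<bar>s\<bar><..} t * G s t \<partial>lborel \<partial>lborel)"
    by (subst nn_integral_PiM_radial[OF A(1) \<open>A \<noteq> {}\<close>]) (auto simp: A(4))
  finally show ?thesis .
qed

text \<open>By homogeneity and scaling, the \<open>h\<close>-weighted mass of the ball of radius
  \<open>t\<close> is \<open>H * t ^ DIM('a)\<close>. This is the distribution function of the norm
  under the weight \<open>h\<close>, and its derivative is the radial density.\<close>

lemma nn_integral_polar_homogeneous:
  fixes h :: "'a::euclidean_space \<Rightarrow> ennreal" and g :: "real \<Rightarrow> ennreal"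
  assumes h [measurable]: "h \<in> borel_measurable borel" and [measurable]: "g \<in> borel_measurable borel"
    and hom: "\<And>t x. t > 0 \<Longrightarrow> h (t *\<^sub>R x) = h x"
    and H: "(\<integral>\<^sup>+ x. h x * indicator (cball 0 1) x \<partial>lborel) = ennreal H" "H \<ge> 0"
  shows "(\<integral>\<^sup>+ x. h x * g (norm x) \<partial>lborel)
    = (\<integral>\<^sup>+ t. ennreal (H * DIM('a) * t ^ (DIM('a) - 1)) * indicator {0<..} t * g t \<partial>lborel)"
proof -
  have [measurable]: "(\<lambda>x. h x * indicator (cball 0 r) x) \<in> borel_measurable borel" for r
    by (intro borel_measurable_times_ennreal borel_measurable_indicator) auto
  let ?N = "distr (density lborel h) borel norm" and ?f = "\<lambda>t. H * DIM('a) * t ^ (DIM('a) - 1)"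
  have "?N = density lborel (\<lambda>t. ennreal (?f t) * indicator {0<..} t)"
  proof (rule density_eqI_cdf[where F = "\<lambda>t. H * t ^ DIM('a)"])
    fix t :: real assume t: "0 < t"
    show "((\<lambda>t. H * t ^ DIM('a)) has_real_derivative ?f t) (at t)"
      by (auto intro!: derivative_eq_intros)
    show "0 \<le> ?f t" using t H by simp
    have "emeasure ?N {..t} = (\<integral>\<^sup>+ x. h x * indicator (cball 0 t) x \<partial>lborel)"
    proof -
      have "norm -` {..t} = cball (0 :: 'a) t" by auto
      then show ?thesis
        by (simp add: emeasure_distr emeasure_density)
    qed
    also have "\<dots> = (\<integral>\<^sup>+ x. h x * indicator (cball 0 t) x
        \<partial>density (distr lborel borel (\<lambda>x. 0 + t *\<^sub>R x)) (\<lambda>_. ennreal (\<bar>t\<bar> ^ DIM('a))))"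
      using t by (subst lborel_affine[of t 0]) auto
    also have "\<dots> = (\<integral>\<^sup>+ x. ennreal (t ^ DIM('a)) * (h (t *\<^sub>R x) * indicator (cball 0 t) (t *\<^sub>R x)) \<partial>lborel)"
      using t by (simp add: nn_integral_density nn_integral_distr)
    also have "\<dots> = (\<integral>\<^sup>+ x. ennreal (t ^ DIM('a)) * (h x * indicator (cball 0 1) x) \<partial>lborel)"
      using t by (intro nn_integral_cong) (auto simp: hom indicator_def)
    also have "\<dots> = ennreal (t ^ DIM('a)) * ennreal H"
      by (subst nn_integral_cmult) (auto simp: H)
    also have "\<dots> = ennreal (H * t ^ DIM('a))"
      using t H by (simp add: ennreal_mult[symmetric] mult.commute)
    finally show "emeasure ?N {..t} = ennreal (H * t ^ DIM('a))" .
  qed (auto intro!: continuous_intros)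
  then have "(\<integral>\<^sup>+ t. g t \<partial>?N) = (\<integral>\<^sup>+ t. g t \<partial>density lborel (\<lambda>t. ennreal (?f t) * indicator {0<..} t))"
    by simp
  then show ?thesis
    by (subst (asm) nn_integral_distr) (auto simp: nn_integral_density)
qed

section \<open>Evaluation of the integral over the unit ball\<close>

text \<open>The ball and the factor \<open>of_nat DIM('a)\<close> appear because the cone definition
  of \<open>sphere_measure\<close> unfolds to exactly this expression.\<close>

lemma nn_integral_power_spherical_cball:
  fixes \<mu> :: "'a::euclidean_space" and \<kappa> \<alpha> \<beta> :: real
  assumes d: "DIM('a) \<ge> 2" and \<mu>: "norm \<mu> = 1" and \<kappa>: "\<kappa> \<ge> 0"
    and \<alpha>: "\<alpha> = (real DIM('a) - 1) / 2 + \<kappa>" and \<beta>: "\<beta> = (real DIM('a) - 1) / 2"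
  shows "of_nat DIM('a) *
      (\<integral>\<^sup>+ x. ennreal ((1 + \<mu> \<bullet> (x /\<^sub>R norm x)) powr \<kappa>) * indicator (cball 0 1) x \<partial>lborel)
    = ennreal (2 powr (\<alpha> + \<beta>) * pi powr \<beta> * Gamma \<alpha> / Gamma (\<alpha> + \<beta>))"
proof -
  define n where "n = DIM('a) - 1"
  have n: "real n = 2 * \<beta>" "n > 0" "DIM('a) = Suc n"
    using d by (auto simp: n_def \<beta> of_nat_diff)
  have \<alpha>\<beta>: "\<alpha> = \<beta> + \<kappa>" by (simp add: \<alpha> \<beta>)
  have pos: "\<alpha> > 0" "\<beta> > 0" using \<kappa> n \<alpha>\<beta> by auto
  define h :: "'a \<Rightarrow> ennreal" where "h = (\<lambda>x. ennreal ((1 + \<mu> \<bullet> (x /\<^sub>R norm x)) powr \<kappa>))"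
  have [measurable]: "h \<in> borel_measurable borel" by (simp add: h_def)
  \<comment> \<open>The exponent \<open>\<kappa> - 1\<close> is chosen for the cylindrical side:
    with the factor \<open>t\<close> of the density there it gives \<open>t powr \<kappa>\<close>,
    which cancels the denominator of \<open>(1 + s / t) powr \<kappa>\<close>.\<close>
  define g :: "real \<Rightarrow> ennreal" where "g = (\<lambda>t. ennreal (t powr (\<kappa> - 1) * exp (- t)))"
  have [measurable]: "g \<in> borel_measurable borel" by (simp add: g_def)
  \<comment> \<open>Cauchy-Schwarz bounds \<open>h\<close> by \<open>2 powr \<kappa>\<close>, so the
    ball integral is a finite number \<open>H\<close> and the final comparison can be made in the
    reals.\<close>
  have "(\<integral>\<^sup>+ x. h x * indicator (cball 0 1) x \<partial>lborel)
      \<le> (\<integral>\<^sup>+ x. ennreal (2 powr \<kappa>) * indicator (cball (0::'a) 1) x \<partial>lborel)"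
  proof (intro nn_integral_mono mult_right_mono)
    fix x :: 'a
    have "\<bar>\<mu> \<bullet> (x /\<^sub>R norm x)\<bar> \<le> norm \<mu> * norm (x /\<^sub>R norm x)" by (rule Cauchy_Schwarz_ineq2)
    also have "\<dots> \<le> 1" using \<mu> by (cases "x = 0") auto
    finally show "h x \<le> ennreal (2 powr \<kappa>)"
      unfolding h_def using \<kappa> by (intro ennreal_leI powr_mono2) auto
  qed simp
  also have "\<dots> < \<infinity>"
    by (subst nn_integral_cmult_indicator) (auto simp: emeasure_cball ennreal_mult_less_top)
  finally obtain H where H: "(\<integral>\<^sup>+ x. h x * indicator (cball 0 1) x \<partial>lborel) = ennreal H" "H \<ge> 0"
    by (cases "\<integral>\<^sup>+ x. h x * indicator (cball 0 1) x \<partial>lborel") auto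
  have "(\<integral>\<^sup>+ x. h x * g (norm x) \<partial>lborel)
      = (\<integral>\<^sup>+ t. ennreal (H * DIM('a) * t ^ (DIM('a) - 1)) * indicator {0<..} t * g t \<partial>lborel)"
    using H by (intro nn_integral_polar_homogeneous) (auto simp: h_def field_simps)
  \<comment> \<open>As \<open>DIM('a) - 1 = 2 * \<beta>\<close>, the powers of \<open>t\<close> add
    up to \<open>2 * \<beta> + \<kappa> - 1 = \<alpha> + \<beta> - 1\<close>, the exponent in
    Euler's integral for \<open>Gamma (\<alpha> + \<beta>)\<close>.\<close>
  also have "\<dots> = (\<integral>\<^sup>+ t. ennreal (H * DIM('a)) * ennreal (indicator {0..} t * t powr (\<alpha> + \<beta> - 1) / exp t) \<partial>lborel)"
  proof (intro nn_integral_cong_AE AE_I[of _ _ "{0}"] subsetI, clarsimp, rule ccontr)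
    fix t :: real
    assume ne: "ennreal (H * real DIM('a) * t ^ (DIM('a) - Suc 0)) * indicator {0<..} t * g t \<noteq>
        ennreal (H * real DIM('a)) * ennreal (indicator {0..} t * t powr (\<alpha> + \<beta> - 1) / exp t)" and "t \<noteq> 0"
    then have t: "t > 0" by (cases "t > 0") (auto simp: indicator_def)
    have "t ^ n * (t powr (\<kappa> - 1) * exp (- t)) = t powr (\<alpha> + \<beta> - 1) / exp t"
      using t n by (simp add: powr_realpow[symmetric] \<alpha>\<beta> exp_minus divide_inverse powr_add[symmetric])
        (simp add: algebra_simps)
    then show False
      using ne t H(2) n by (simp add: g_def ennreal_mult[symmetric] mult.assoc)
  qed auto
  also have "\<dots> = ennreal (H * DIM('a)) * Gamma (\<alpha> + \<beta>)"
    using Gamma_conv_nn_integral_real[of "\<alpha> + \<beta>"] pos by (subst nn_integral_cmult) auto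
  finally have polar: "(\<integral>\<^sup>+ x. h x * g (norm x) \<partial>lborel) = ennreal (H * DIM('a)) * Gamma (\<alpha> + \<beta>)" .

  obtain b :: 'a where b: "b \<in> Basis" by (meson nonempty_Basis ex_in_conv)
  \<comment> \<open>\<open>T\<close> goes from \<open>b\<close> to \<open>\<mu>\<close>, since it is
    substituted for the variable: \<open>\<mu> \<bullet> T x\<close> is then the coordinate
    \<open>b \<bullet> x\<close>.\<close>
  obtain T where T: "orthogonal_transformation T" "T b = \<mu>"
    using orthogonal_transformation_exists_euclidean[of b \<mu>] b \<mu> by auto
  have Ti: "\<mu> \<bullet> T x = b \<bullet> x" "norm (T x) = norm x" for x
    using T by (metis orthogonal_transformation_def) (use T in \<open>simp add: orthogonal_transformation\<close>)
  \<comment> \<open>Here \<open>s / t\<close> stands for the inner product with the normalised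
    vector; at the origin division by zero gives 0 on both sides, so the rewriting holds
    everywhere.\<close>
  define G where "G = (\<lambda>s t. ennreal ((1 + s / t) powr \<kappa>) * g t)"
  have "(\<integral>\<^sup>+ x. h x * g (norm x) \<partial>lborel) = (\<integral>\<^sup>+ x. h (T x) * g (norm (T x)) \<partial>lborel)"
    by (rule nn_integral_orthogonal_transformation[OF T(1), symmetric]) simp
  also have "\<dots> = (\<integral>\<^sup>+ x. G (b \<bullet> x) (norm x) \<partial>lborel)"
    by (simp add: h_def G_def Ti divide_inverse mult.commute)
  also have "\<dots> = (\<integral>\<^sup>+ s. \<integral>\<^sup>+ t. ennreal (real n * unit_ball_vol n * t * (t\<^sup>2 - s\<^sup>2) powr (n / 2 - 1))
          * indicator {\<bar>s\<bar><..} t * G s t \<partial>lborel \<partial>lborel)"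
    unfolding n_def by (rule nn_integral_cylindrical[OF d b]) (simp add: G_def)
  also have "\<dots> = (\<integral>\<^sup>+ s. \<integral>\<^sup>+ t. ennreal (n * unit_ball_vol n) * ennreal (indicator {\<bar>s\<bar><..} t *
      ((t + s) powr (\<alpha> - 1) * (t - s) powr (\<beta> - 1) * exp (- t))) \<partial>lborel \<partial>lborel)"
  proof (intro nn_integral_cong)
    fix s t :: real
    show "ennreal (n * unit_ball_vol n * t * (t\<^sup>2 - s\<^sup>2) powr (n / 2 - 1)) * indicator {\<bar>s\<bar><..} t * G s t
      = ennreal (n * unit_ball_vol n) * ennreal (indicator {\<bar>s\<bar><..} t *
      ((t + s) powr (\<alpha> - 1) * (t - s) powr (\<beta> - 1) * exp (- t)))"
    proof (cases "\<bar>s\<bar> < t")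
      case True
      then have p: "t > 0" "t + s > 0" "t - s > 0" by auto
      have "t\<^sup>2 - s\<^sup>2 = (t + s) * (t - s)" by (simp add: power2_eq_square algebra_simps)
      then have 1: "(t\<^sup>2 - s\<^sup>2) powr (n / 2 - 1) = (t + s) powr (\<beta> - 1) * (t - s) powr (\<beta> - 1)"
        using p by (simp add: powr_mult n)
      have 2: "(1 + s / t) powr \<kappa> = (t + s) powr \<kappa> / t powr \<kappa>"
        using p by (simp add: powr_divide[symmetric] add_divide_distrib)
      have 3: "t * t powr (\<kappa> - 1) = t powr \<kappa>"
        using p by (simp add: powr_diff)
      have "t * (t\<^sup>2 - s\<^sup>2) powr (n / 2 - 1) * ((1 + s / t) powr \<kappa> * (t powr (\<kappa> - 1) * exp (- t)))
        = (t * t powr (\<kappa> - 1) / t powr \<kappa>) * ((t + s) powr (\<beta> - 1) * (t + s) powr \<kappa>) * (t - s) powr (\<beta> - 1) * exp (- t)"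
        unfolding 1 2 by simp
      also have "\<dots> = (t + s) powr (\<alpha> - 1) * (t - s) powr (\<beta> - 1) * exp (- t)"
        using p unfolding 3 by (simp add: powr_add[symmetric] \<alpha>\<beta> algebra_simps)
      finally show ?thesis
        using True p by (simp add: G_def g_def ennreal_mult[symmetric] mult.assoc)
    qed simp
  qed
  also have "\<dots> = ennreal (n * unit_ball_vol n) * (\<integral>\<^sup>+ s. \<integral>\<^sup>+ t. ennreal (indicator {\<bar>s\<bar><..} t *
      ((t + s) powr (\<alpha> - 1) * (t - s) powr (\<beta> - 1) * exp (- t))) \<partial>lborel \<partial>lborel)"
  proof -
    \<comment> \<open>Pulling the constant out of the outer integral needs measurability of the
      inner one, which follows from joint measurability of \<open>K\<close>.\<close>
    define K where "K = (\<lambda>s t. ennreal (indicator {\<bar>s\<bar><..} t *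
      ((t + s) powr (\<alpha> - 1) * (t - s) powr (\<beta> - 1) * exp (- t))))"
    have [measurable]: "case_prod K \<in> borel_measurable (borel \<Otimes>\<^sub>M borel)"
      by (simp add: K_def case_prod_unfold indicator_def)
    show ?thesis
      unfolding K_def[THEN fun_cong, THEN fun_cong, symmetric] by (simp add: nn_integral_cmult)
  qed
  also have "\<dots> = ennreal (n * unit_ball_vol n) * ennreal (2 powr (\<alpha> + \<beta> - 1) * Gamma \<alpha> * Gamma \<beta>)"
    by (simp only: nn_integral_gamma_product[OF pos])
  finally have "ennreal (H * DIM('a)) * ennreal (Gamma (\<alpha> + \<beta>))
      = ennreal (n * unit_ball_vol n) * ennreal (2 powr (\<alpha> + \<beta> - 1) * Gamma \<alpha> * Gamma \<beta>)"
    unfolding polar .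
  then have "H * DIM('a) * Gamma (\<alpha> + \<beta>) = n * unit_ball_vol n * (2 powr (\<alpha> + \<beta> - 1) * Gamma \<alpha> * Gamma \<beta>)"
    using H(2) pos by (simp add: ennreal_mult[symmetric] Gamma_real_nonneg)
  also have "\<dots> = 2 powr (\<alpha> + \<beta>) * pi powr \<beta> * Gamma \<alpha>"
  proof -
    \<comment> \<open>As \<open>n / 2 = \<beta>\<close>, the ball volume is
      \<open>pi powr \<beta> / Gamma (\<beta> + 1)\<close>. The functional equation turns
      \<open>n\<close> times it into \<open>2 * pi powr \<beta> / Gamma \<beta>\<close>, which
      cancels \<open>Gamma \<beta>\<close> and restores the missing factor 2.\<close>
    have "Gamma \<beta> \<noteq> 0" "Gamma (\<beta> + 1) = \<beta> * Gamma \<beta>"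
      using pos Gamma_real_pos[of \<beta>] by (auto intro!: Gamma_plus1 elim: nonpos_Ints_cases simp del: Gamma_real_pos)
    then have "n * unit_ball_vol n * Gamma \<beta> = 2 * pi powr \<beta>"
      using \<open>Gamma \<beta> \<noteq> 0\<close> \<open>Gamma (\<beta> + 1) = \<beta> * Gamma \<beta>\<close> pos
      by (simp add: unit_ball_vol_def n)
    then have "n * unit_ball_vol n * Gamma \<beta> * (2 powr (\<alpha> + \<beta> - 1) * Gamma \<alpha>)
      = 2 * pi powr \<beta> * (2 powr (\<alpha> + \<beta> - 1) * Gamma \<alpha>)" by simp
    then show ?thesis by (simp add: powr_diff mult_ac)
  qed
  finally have "DIM('a) * H = 2 powr (\<alpha> + \<beta>) * pi powr \<beta> * Gamma \<alpha> / Gamma (\<alpha> + \<beta>)"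
    using pos Gamma_real_pos[of "\<alpha> + \<beta>"]
    by (subst eq_divide_eq) (auto simp: mult_ac simp del: Gamma_real_pos)
  then show ?thesis
    using H unfolding h_def by (simp add: ennreal_of_nat_eq_real_of_nat ennreal_mult[symmetric])
qed

section \<open>Transfer to the surface measure\<close>

text \<open>Unfolding the scaled push-forward leaves an integral over the punctured ball; the origin
  is a null set and may be put back.\<close>

lemma nn_integral_sphere_measure:
  fixes f :: "'a::euclidean_space \<Rightarrow> ennreal"
  assumes [measurable]: "f \<in> borel_measurable borel"
  shows "(\<integral>\<^sup>+ x. f x \<partial>sphere_measure) =
    of_nat DIM('a) * (\<integral>\<^sup>+ x. f (x /\<^sub>R norm x) * indicator (cball 0 1) x \<partial>lborel)"
proof -
  let ?R = "restrict_space lborel (cball 0 1 - {0}) :: 'a measure"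
  let ?S = "restrict_space borel (sphere 0 1) :: 'a measure"
  have m: "(\<lambda>x. x /\<^sub>R norm x) \<in> ?R \<rightarrow>\<^sub>M ?S"
    by (intro measurable_restrict_space2 measurable_restrict_space1) (auto simp: space_restrict_space)
  have fS: "f \<in> borel_measurable ?S" by (intro measurable_restrict_space1) simp
  have "(\<integral>\<^sup>+ x. f x \<partial>sphere_measure) = of_nat DIM('a) * (\<integral>\<^sup>+ x. f (x /\<^sub>R norm x) \<partial>?R)"
    unfolding sphere_measure_def using m fS
    by (subst nn_integral_scale_measure) (auto simp: nn_integral_distr)
  also have "(\<integral>\<^sup>+ x. f (x /\<^sub>R norm x) \<partial>?R) = (\<integral>\<^sup>+ x. f (x /\<^sub>R norm x) * indicator (cball 0 1 - {0}) x \<partial>lborel)"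
    by (subst nn_integral_restrict_space) auto
  also have "\<dots> = (\<integral>\<^sup>+ x. f (x /\<^sub>R norm x) * indicator (cball 0 1) x \<partial>lborel)"
    by (intro nn_integral_cong_AE AE_I[of _ _ "{0}"]) (auto simp: indicator_def)
  finally show ?thesis .
qed

theorem theorem13:
  fixes \<mu> :: "'a::euclidean_space" and \<kappa> \<alpha> \<beta> :: real
  assumes "DIM('a) \<ge> 2"
    and "\<mu> \<in> sphere 0 1"
    and "\<kappa> \<ge> 0"
    and "\<alpha> = (real DIM('a) - 1) / 2 + \<kappa>"
    and "\<beta> = (real DIM('a) - 1) / 2"
  shows "integrable sphere_measure (\<lambda>x. (1 + \<mu> \<bullet> x) powr \<kappa>)
    \<and> (\<integral>x. (1 + \<mu> \<bullet> x) powr \<kappa> \<partial>sphere_measure)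
        = 2 powr (\<alpha> + \<beta>) * pi powr \<beta> * Gamma \<alpha> / Gamma (\<alpha> + \<beta>)
    \<and> (\<integral>x. power_spherical_density \<mu> \<kappa> x \<partial>sphere_measure) = 1"
proof -
  define C where "C = 2 powr (\<alpha> + \<beta>) * pi powr \<beta> * Gamma \<alpha> / Gamma (\<alpha> + \<beta>)"
  have "\<beta> > 0" using assms by simp
  moreover from this have "\<alpha> > 0" using assms by linarith
  ultimately have C: "C > 0" by (simp add: C_def Gamma_real_pos)
  have nn: "(\<integral>\<^sup>+ x. ennreal ((1 + \<mu> \<bullet> x) powr \<kappa>) \<partial>sphere_measure) = ennreal C"
    unfolding C_def using nn_integral_power_spherical_cball[OF assms(1) _ assms(3-5)] assms(2)
    by (subst nn_integral_sphere_measure) simp_all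
  \<comment> \<open>\<open>sphere_measure\<close> carries the trace of the Borel sets on the sphere,
    so measurability is inherited by restriction.\<close>
  have m: "(\<lambda>x. (1 + \<mu> \<bullet> x) powr \<kappa>) \<in> borel_measurable sphere_measure"
    by (subst measurable_cong_sets[where M' = "restrict_space borel (sphere 0 1)" and N' = borel])
       (auto simp: sphere_measure_def intro!: measurable_restrict_space1)
  have int: "integrable sphere_measure (\<lambda>x. (1 + \<mu> \<bullet> x) powr \<kappa>)"
    using m nn by (intro integrableI_nonneg) auto
  have val: "(\<integral>x. (1 + \<mu> \<bullet> x) powr \<kappa> \<partial>sphere_measure) = C"
    using m nn C by (subst integral_eq_nn_integral) auto
  \<comment> \<open>The normalising constant in the density is literally \<open>C\<close>, so the
    last claim is the second one divided by \<open>C\<close>.\<close>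
  have "power_spherical_density \<mu> \<kappa> = (\<lambda>x. (1 + \<mu> \<bullet> x) powr \<kappa> / C)"
    unfolding power_spherical_density_def Let_def C_def assms(4,5) ..
  then have "(\<integral>x. power_spherical_density \<mu> \<kappa> x \<partial>sphere_measure) = 1"
    using val C by simp
  with int val show ?thesis unfolding C_def by blast
qed

end
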